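(* Let $G$ be a metric group with $|G|=N>4$ and let $E\colon G\to\mathbb{C}$ be a finite quantum dilogarithm for $G$, with constant $C\in\mathbb{C}^\times$. Then: (i) $E(0)^2=\sqrt N\,E(0)+1$ and $C=-\widehat E(0)$; (ii) $E(u)E(-u)=\langle u\rangle^{-1}$ for all $u\in G$, $u\ne0$; (iii) $\widehat E(u)=\lambda\langle u\rangle E(u)$ for all $u\in G$, where $\lambda=\widehat E(0)/E(0)$ satisfies $\lambda^3=\frac1{\sqrt N}\sum_{x\in G}\langle x\rangle^{-1}$; (iv) the function $\widetilde E(u)=\langle u\rangle E(u)$ satisfies, for all $x,y\in G$, the dual pentagon equation $$\langle x;y\rangle^{-1}\widetilde E(x)\widetilde E(y)=\widetilde C+\frac1{\sqrt N}\sum_{z\in G}\widetilde E(y-z)\widetilde E(z)\langle z\rangle^{-1}\widetilde E(x-z)$$ with $\widetilde C=\lambda^{-2}C$.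
   Context: A metric group is a finite abelian group $G$ together with a function $\langle\cdot\rangle\colon G\to\mathbb{C}^\times$ such that $\langle x\rangle=\langle -x\rangle$ for all $x$ and $\langle x;y\rangle:=\dfrac{\langle x+y\rangle}{\langle x\rangle\langle y\rangle}$ is a non-degenerate bicharacter on $G$. For $N=|G|$ the Fourier transform of $f\colon G\to\mathbb{C}$ is $\widehat f(y)=\frac1{\sqrt N}\sum_{x\in G}f(x)\langle x;-y\rangle$. A finite quantum dilogarithm for a metric group $G$ with $|G|>1$ is a function $E\colon G\to\mathbb{C}$ such that for some non-zero constant $C\in\mathbb{C}^\times$ and all $x,y\in G$, $$\langle x;y\rangle E(x)E(y)=C+\frac1{\sqrt N}\sum_{z\in G}E(y-z)E(z)\langle z\rangle E(x-z).$$ *)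

theory Defs
  imports Complex_Main "HOL-Library.Cardinality"
begin

text \<open>
  The finite abelian group is the whole type, of sort \<open>{finite, ab_group_add}\<close>, so its
  order is \<open>CARD('a)\<close>.  In the names below, \<open>q x\<close> stands for \<open>\<langle>x\<rangle>\<close> and
  \<open>bich q x y\<close> for \<open>\<langle>x;y\<rangle>\<close>.
\<close>

definition bicharacter :: "('a::ab_group_add \<Rightarrow> 'a \<Rightarrow> complex) \<Rightarrow> bool" where
  "bicharacter b \<longleftrightarrow>
     (\<forall>x y. b x y \<noteq> 0) \<and>
     (\<forall>x x' y. b (x + x') y = b x y * b x' y) \<and>
     (\<forall>x y y'. b x (y + y') = b x y * b x y')"

definition nondegenerate :: "('a::ab_group_add \<Rightarrow> 'a \<Rightarrow> complex) \<Rightarrow> bool" where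
  "nondegenerate b \<longleftrightarrow>
     (\<forall>x. (\<forall>y. b x y = 1) \<longrightarrow> x = 0) \<and>
     (\<forall>y. (\<forall>x. b x y = 1) \<longrightarrow> y = 0)"

definition bich :: "('a::ab_group_add \<Rightarrow> complex) \<Rightarrow> 'a \<Rightarrow> 'a \<Rightarrow> complex" where
  "bich q x y = q (x + y) / (q x * q y)"

definition metric_group :: "('a::{finite, ab_group_add} \<Rightarrow> complex) \<Rightarrow> bool" where
  "metric_group q \<longleftrightarrow>
     (\<forall>x. q x \<noteq> 0) \<and> (\<forall>x. q (- x) = q x) \<and>
     bicharacter (bich q) \<and> nondegenerate (bich q)"

definition fourier ::
  "('a::{finite, ab_group_add} \<Rightarrow> complex) \<Rightarrow> ('a \<Rightarrow> complex) \<Rightarrow> 'a \<Rightarrow> complex" where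
  "fourier q f y =
     1 / of_real (sqrt (real CARD('a))) * (\<Sum>x\<in>UNIV. f x * bich q x (- y))"

definition dilogarithm_with_constant ::
  "('a::{finite, ab_group_add} \<Rightarrow> complex) \<Rightarrow> ('a \<Rightarrow> complex) \<Rightarrow> complex \<Rightarrow> bool" where
  "dilogarithm_with_constant q E C \<longleftrightarrow>
     CARD('a) > 1 \<and> C \<noteq> 0 \<and>
     (\<forall>x y. bich q x y * E x * E y =
        C + 1 / of_real (sqrt (real CARD('a))) *
          (\<Sum>z\<in>UNIV. E (y - z) * E z * q z * E (x - z)))"

end

theory Submission
  imports Defs
begin

text \<open>
  With \<open>N = |G|\<close> and \<open>s = sqrt N\<close>, taking the Fourier transform of the pentagon equation in \<open>x\<close> gives
  \<open>E y * Eh (w - y) = s * C * [w = 0] + Eh w * P y w\<close>,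
  where \<open>Eh\<close> is the transform of \<open>E\<close> and \<open>P y\<close> that of \<open>z \<mapsto> E (y - z) * E z * q z\<close>. The symmetry
  \<open>z \<mapsto> y - z\<close> of \<open>P y\<close> shows that \<open>E\<close> and \<open>Eh\<close> have no zeros away from 0. The case \<open>y = 0\<close> then
  gives \<open>E u * E (- u) * q u = c\<close> for \<open>u \<noteq> 0\<close>, and the cases \<open>w = 0\<close> and \<open>w = y\<close> give
  \<open>Eh u = lam * q u * E u\<close> for \<open>u \<noteq> 0\<close>. It remains to see that this proportionality also holds at 0,
  i.e. that \<open>E 0 = e'\<close> for \<open>e' = Eh 0 / lam\<close>. Fourier inversion for \<open>P y\<close> yields
  \<open>s * (e' - c * E 0) = (E 0 - e') * E y * (1 + q y)\<close> for \<open>y \<noteq> 0\<close>. If \<open>E 0 = e'\<close>, then \<open>c = 1\<close>.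
  Otherwise \<open>E y * (1 + q y)\<close> is constant on \<open>y \<noteq> 0\<close>; transforming \<open>E\<close> twice gives \<open>lam\<^sup>2 = 1\<close> and
  determines \<open>q y + 1 / q y\<close> as a rational function of \<open>lam * s\<close>, and this value violates the
  Gauss sum identity \<open>|\<Sum>x. q x| = s\<close> as soon as \<open>N > 4\<close>.
\<close>

section \<open>Metric groups and their Fourier transform\<close>

locale metric_grp =
  fixes q :: "'a::{finite, ab_group_add} \<Rightarrow> complex" and s :: complex
  assumes metric: "metric_group q"
    and s_def: "s = complex_of_real (sqrt (real CARD('a)))"
begin

abbreviation b :: "'a \<Rightarrow> 'a \<Rightarrow> complex" where "b \<equiv> bich q"
abbreviation F :: "('a \<Rightarrow> complex) \<Rightarrow> 'a \<Rightarrow> complex" where "F \<equiv> fourier q"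

lemma q_nonzero [simp]: "q x \<noteq> 0" and q_minus [simp]: "q (- x) = q x"
  using metric by (auto simp: metric_group_def)

lemma b_nonzero [simp]: "b x y \<noteq> 0"
  and b_add_left: "b (x + x') y = b x y * b x' y"
  and b_add_right: "b x (y + y') = b x y * b x y'"
  using metric unfolding metric_group_def bicharacter_def by blast+

lemma b_commute: "b x y = b y x"
  by (simp add: bich_def add.commute mult.commute)

lemma b_zero [simp]: "b 0 y = 1" "b x 0 = 1"
  using b_add_left[of 0 0 y] b_add_right[of x 0 0] by auto

lemma b_minus_right: "b x (- y) = inverse (b x y)"
  using b_add_right[of x y "- y"] by (simp add: field_simps)

lemma b_minus_left: "b (- x) y = inverse (b x y)"
  using b_add_left[of x "- x" y] by (simp add: field_simps)

lemma b_diff_left: "b (x - x') y = b x y / b x' y"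
  using b_add_left[of x "- x'" y] by (simp add: b_minus_left field_simps)

lemma b_diff_right: "b x (y - y') = b x y / b x y'"
  using b_add_right[of x y "- y'"] by (simp add: b_minus_right field_simps)

lemma q_zero [simp]: "q 0 = 1"
  using b_zero(1)[of 0] unfolding bich_def by simp

lemma q_add: "q (x + y) = q x * q y * b x y"
  by (simp add: bich_def)

lemma q_diff: "q (x - y) = q x * q y / b x y"
  using q_add[of x "- y"] by (simp add: b_minus_right field_simps)

lemma b_self: "b x x = (q x)\<^sup>2"
  using q_diff[of x x] by (simp add: field_simps power2_eq_square)

lemma s_nonzero [simp]: "s \<noteq> 0"
  by (simp add: s_def)

lemma fourier_eq: "F f w = 1 / s * (\<Sum>x\<in>UNIV. f x * b x (- w))"
  by (simp add: fourier_def s_def)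

lemma s_square: "s * s = of_nat CARD('a)"
  unfolding s_def by (metis of_real_mult of_real_of_nat_eq real_sqrt_mult_self abs_of_nat)

text \<open>Orthogonality of characters: translating by \<open>t\<close> multiplies the sum by
  \<open>b x t \<noteq> 1\<close>.\<close>

lemma sum_b: "(\<Sum>y\<in>UNIV. b x y) = (if x = 0 then s * s else 0)"
proof (cases "x = 0")
  case True
  then show ?thesis unfolding s_square by simp
next
  case False
  then obtain t where t: "b x t \<noteq> 1"
    using metric unfolding metric_group_def nondegenerate_def by blast
  have "(\<Sum>y\<in>UNIV. b x y) = (\<Sum>y\<in>UNIV. b x (y + t))"
    by (rule sum.reindex_bij_witness[of _ "\<lambda>y. y + t" "\<lambda>y. y - t"]) auto
  also have "\<dots> = (\<Sum>y\<in>UNIV. b x y) * b x t"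
    by (simp add: b_add_right sum_distrib_right)
  finally show ?thesis using t False by auto
qed

lemma sum_b': "(\<Sum>x\<in>UNIV. b x y) = (if y = 0 then s * s else 0)"
  using sum_b[of y] by (simp add: b_commute[of _ y])

text \<open>A maximiser of the multiplicative function \<open>x \<mapsto> |b x y|\<close> has value at most 1.\<close>
lemma norm_b: "norm (b x y) = 1"
proof -
  define f where "f x = norm (b x y)" for x
  have pos: "f x > 0" for x by (simp add: f_def)
  obtain m where m: "\<And>x. f x \<le> f m"
  proof -
    have "Max (range f) \<in> range f" by (intro Max_in) auto
    then obtain m where "Max (range f) = f m" by blast
    then show thesis using that[of m] Max_ge[of "range f"] by simp
  qed
  have "f (m + m) = f m * f m" by (simp add: f_def b_add_left norm_mult)
  then have "f m \<le> 1" using m[of "m + m"] pos[of m] by simp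
  then have le: "f x \<le> 1" for x using m[of x] by linarith
  have "f (- x) = inverse (f x)" by (simp add: f_def b_minus_left norm_inverse)
  then show ?thesis using le[of x] le[of "- x"] pos[of x]
    unfolding f_def[symmetric] by (simp add: inverse_le_1_iff)
qed

section \<open>Absolute values and Gauss sums\<close>

lemma norm_q: "norm (q x) = 1"
proof -
  have "norm (q x) ^ 2 = 1" using norm_b[of x x] by (simp add: b_self norm_power)
  then show ?thesis by (simp add: power2_eq_1_iff) (smt (verit) norm_ge_zero)
qed

lemma inverse_q: "inverse (q x) = cnj (q x)"
  using norm_q[of x] by (simp add: divide_conv_cnj inverse_eq_divide)

text \<open>With \<open>x = d + y\<close> the term \<open>q x / q y\<close> becomes
  \<open>q d * b d y\<close>, and summing over \<open>y\<close> leaves only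
  \<open>d = 0\<close>.\<close>

lemma gauss_sum: "(\<Sum>x\<in>UNIV. q x) * (\<Sum>x\<in>UNIV. inverse (q x)) = s * s"
proof -
  have "(\<Sum>x\<in>UNIV. q x) * (\<Sum>y\<in>UNIV. inverse (q y))
      = (\<Sum>y\<in>UNIV. \<Sum>x\<in>UNIV. q x * inverse (q y))"
    by (simp add: sum_product) (rule sum.swap)
  also have "\<dots> = (\<Sum>y\<in>UNIV. \<Sum>d\<in>UNIV. q d * b d y)"
  proof (rule sum.cong[OF refl])
    fix y
    show "(\<Sum>x\<in>UNIV. q x * inverse (q y)) = (\<Sum>d\<in>UNIV. q d * b d y)"
      by (rule sum.reindex_bij_witness[of _ "\<lambda>d. d + y" "\<lambda>x. x - y"])
        (auto simp: q_diff b_diff_left b_self field_simps power2_eq_square)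
  qed
  also have "\<dots> = (\<Sum>d\<in>UNIV. \<Sum>y\<in>UNIV. q d * b d y)"
    by (rule sum.swap)
  also have "\<dots> = (\<Sum>d\<in>(UNIV::'a set). if d = 0 then s * s else 0)"
    by (rule sum.cong) (auto simp: sum_distrib_left[symmetric] sum_b)
  finally show ?thesis by simp
qed

lemma norm_gauss_sum: "norm (\<Sum>x\<in>UNIV. q x) = sqrt (real CARD('a))"
proof -
  have "(\<Sum>x\<in>UNIV. inverse (q x)) = cnj (\<Sum>x\<in>UNIV. q x)"
    by (simp add: inverse_q)
  then have "complex_of_real ((norm (\<Sum>x\<in>UNIV. q x))\<^sup>2) = of_real (real CARD('a))"
    using gauss_sum unfolding s_square by (simp add: complex_norm_square flip: of_real_power)
  then have "(norm (\<Sum>x\<in>UNIV. q x))\<^sup>2 = real CARD('a)"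
    using of_real_eq_iff by blast
  then show ?thesis by (metis norm_ge_zero real_sqrt_unique)
qed

lemma norm_gauss_sum_add_inverse:
  "norm ((\<Sum>x\<in>UNIV. q x) + (\<Sum>x\<in>UNIV. inverse (q x))) \<le> 2 * sqrt (real CARD('a))"
proof -
  have "(\<Sum>x\<in>UNIV. inverse (q x)) = cnj (\<Sum>x\<in>UNIV. q x)"
    by (simp add: inverse_q)
  then have "norm (\<Sum>x\<in>UNIV. inverse (q x)) = sqrt (real CARD('a))"
    by (metis complex_mod_cnj norm_gauss_sum)
  then show ?thesis
    using norm_triangle_ineq[of "\<Sum>x\<in>UNIV. q x" "\<Sum>x\<in>UNIV. inverse (q x)"]
      norm_gauss_sum by simp
qed

lemma exists_nonzero:
  assumes "CARD('a) > 1"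
  shows "\<exists>u::'a. u \<noteq> 0"
proof (rule ccontr)
  assume "\<not> ?thesis"
  then have "UNIV = {0::'a}" by auto
  then have "CARD('a) = 1" by (metis is_singletonI is_singleton_altdef)
  then show False using assms by simp
qed

text \<open>For \<open>x \<noteq> 0\<close>, each \<open>b x y\<close> with \<open>y\<close>
  different from 0 and \<open>- x\<close> equals \<open>1 / a\<close>, so orthogonality reads
  \<open>1 + 1 / a\<^sup>2 + (CARD('a) - 2) / a = 0\<close>. Since \<open>norm a = 1\<close>, this
  bounds \<open>CARD('a) - 2\<close> by 2.\<close>

lemma constant_imp_card_le:
  assumes a: "\<And>x. x \<noteq> 0 \<Longrightarrow> q x = a" and card: "CARD('a) > 1"
  shows "CARD('a) \<le> 4"
proof -
  obtain x :: 'a where x: "x \<noteq> 0"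
    using exists_nonzero[OF card] by blast
  have a_nz: "a \<noteq> 0" using a[OF x] q_nonzero by metis
  have "0 = (\<Sum>y\<in>UNIV. b x y)" by (simp add: sum_b x)
  also have "\<dots> = b x 0 + b x (-x) + (\<Sum>y\<in>UNIV - {0, -x}. b x y)"
    using x by (subst sum.remove[of _ 0], simp, simp, subst sum.remove[of _ "-x"])
      (auto simp: Diff_insert2[symmetric])
  also have "(\<Sum>y\<in>UNIV - {0, -x}. b x y) = (\<Sum>y\<in>UNIV - {0, -x}. 1 / a)"
    using x a by (intro sum.cong) (auto simp: bich_def a_nz add_eq_0_iff)
  also have "\<dots> = of_nat (CARD('a) - 2) / a"
    using x by (simp add: card_Diff_subset numeral_2_eq_2)
  also have "b x (-x) = 1 / a\<^sup>2"
    using a[OF x] by (simp add: b_minus_right b_self inverse_eq_divide)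
  finally have "0 = a\<^sup>2 * (1 + 1 / a\<^sup>2 + of_nat (CARD('a) - 2) / a)"
    by simp
  also have "\<dots> = of_nat (CARD('a) - 2) * a + (a\<^sup>2 + 1)"
    using a_nz by (simp add: distrib_left power2_eq_square)
  finally have "of_nat (CARD('a) - 2) * a = - (a\<^sup>2 + 1)"
    unfolding eq_neg_iff_add_eq_0 by (rule sym)
  then have "norm (of_nat (CARD('a) - 2) * a) = norm (a\<^sup>2 + 1)"
    by (metis norm_minus_cancel)
  also have "\<dots> \<le> 2"
    using norm_triangle_ineq[of "a\<^sup>2" 1] norm_q[of x] a[OF x] by (simp add: norm_power)
  finally have "real (CARD('a) - 2) \<le> 2"
    using norm_q[of x] a[OF x] by (simp add: norm_mult)
  then show ?thesis by linarith
qed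

section \<open>Fourier inversion and convolution\<close>

lemma fourier_inverse: "(\<Sum>w\<in>UNIV. F f w * b z w) = s * f z"
proof -
  have "(\<Sum>w\<in>UNIV. F f w * b z w) = 1 / s * (\<Sum>w\<in>UNIV. \<Sum>x\<in>UNIV. f x * b (z - x) w)"
    unfolding fourier_eq sum_distrib_left sum_distrib_right
    by (intro sum.cong refl) (simp add: b_diff_left b_minus_right field_simps)
  also have "\<dots> = 1 / s * (\<Sum>x\<in>UNIV. \<Sum>w\<in>UNIV. f x * b (z - x) w)"
    by (subst sum.swap) simp
  also have "\<dots> = 1 / s * (\<Sum>x\<in>UNIV. if z = x then f x * (s * s) else 0)"
    by (intro arg_cong[of _ _ "(*) _"] sum.cong) (auto simp: sum_distrib_left[symmetric] sum_b)
  finally show ?thesis by simp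
qed

lemma sum_fourier: "(\<Sum>w\<in>UNIV. F f w) = s * f 0"
  using fourier_inverse[of f 0] by simp

lemma fourier_fourier: "F (F f) u = f (- u)"
  using fourier_inverse[of f "- u"]
  unfolding fourier_eq[of "F f"] by (simp add: b_minus_right b_minus_left b_commute)

lemma fourier_inject: "f = g" if "\<And>w. F f w = F g w"
proof
  fix z
  have "F f = F g" using that by auto
  then show "f z = g z" using fourier_inverse[of f z] fourier_inverse[of g z] by simp
qed

lemma fourier_add: "F (\<lambda>x. f x + g x) w = F f w + F g w"
  by (simp add: fourier_eq sum.distrib algebra_simps)

lemma fourier_mult: "F (\<lambda>x. k * f x) w = k * F f w"
  by (simp add: fourier_eq sum_distrib_left algebra_simps)

lemma fourier_const: "F (\<lambda>x. k) w = (if w = 0 then s * k else 0)"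
proof -
  have "(\<Sum>x\<in>UNIV. k * b x (- w)) = (if w = 0 then s * s * k else 0)"
    by (simp add: sum_distrib_left[symmetric] sum_b')
  then show ?thesis by (simp add: fourier_eq)
qed

lemma fourier_delta: "F (\<lambda>x. if x = 0 then k else 0) w = k / s"
proof -
  have "(\<Sum>x\<in>UNIV. (if x = 0 then k else 0) * b x (- w)) = (\<Sum>x\<in>(UNIV::'a set). if x = 0 then k else 0)"
    by (intro sum.cong) auto
  then show ?thesis by (simp add: fourier_eq)
qed

lemma fourier_convolution: "F (\<lambda>x. 1 / s * (\<Sum>z\<in>UNIV. f z * g (x - z))) w = F f w * F g w"
proof -
  have "(\<Sum>x\<in>UNIV. (\<Sum>z\<in>UNIV. f z * g (x - z)) * b x (- w))
      = (\<Sum>z\<in>UNIV. \<Sum>x\<in>UNIV. f z * g (x - z) * b x (- w))"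
    unfolding sum_distrib_right by (rule sum.swap)
  also have "\<dots> = (\<Sum>z\<in>UNIV. \<Sum>x\<in>UNIV. f z * b z (- w) * (g x * b x (- w)))"
  proof (rule sum.cong[OF refl])
    fix z
    show "(\<Sum>x\<in>UNIV. f z * g (x - z) * b x (- w))
      = (\<Sum>x\<in>UNIV. f z * b z (- w) * (g x * b x (- w)))"
      by (rule sum.reindex_bij_witness[of _ "\<lambda>x. x + z" "\<lambda>x. x - z"])
        (auto simp: b_diff_left field_simps)
  qed
  also have "\<dots> = (\<Sum>z\<in>UNIV. f z * b z (- w)) * (\<Sum>x\<in>UNIV. g x * b x (- w))"
    by (simp add: sum_product)
  finally show ?thesis
    unfolding fourier_mult by (simp add: fourier_eq)
qed

lemma fourier_modulate: "F (\<lambda>x. b x y * f x) w = F f (w - y)"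
  unfolding fourier_eq
  by (intro arg_cong[of _ _ "(*) _"] sum.cong) (simp_all add: b_diff_right b_minus_right field_simps)

end

section \<open>The Fourier transform of the pentagon equation\<close>

text \<open>
  Applied with \<open>r = lam * s\<close>: the left-hand side is the value that \<open>|\<Sum>x. q x + 1 / q x|\<close> would have
  if \<open>E 0 \<noteq> e'\<close>.
\<close>
lemma real_gauss_sum_bound:
  fixes r :: real
  assumes r: "r\<^sup>2 \<ge> 5"
  shows "\<bar>2 + (r\<^sup>2 - 1) * (- (r ^ 3 + 2 * r\<^sup>2 - 2) / (1 + r)\<^sup>2)\<bar> > 2 * \<bar>r\<bar>"
proof -
  have abs_r: "\<bar>r\<bar> > 1"
    using r abs_square_le_1[of r] by linarith
  then have r1: "1 + r \<noteq> 0" by auto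
  \<comment> \<open>After cancelling \<open>1 + r\<close>, the expression in the claim is
    \<open>- r / (1 + r)\<close> times this cubic. Both signs of \<open>r\<close> matter, since
    \<open>lam\<close> will be 1 or -1.\<close>
  have "\<bar>r ^ 3 + r\<^sup>2 - 2 * r - 4\<bar> > 2 * \<bar>1 + r\<bar>"
  proof (cases "r > 0")
    case True
    then have pos: "r > 1" using abs_r by linarith
    have "r\<^sup>2 * r \<ge> 5 * r" using r True by (intro mult_right_mono) auto
    then have "r ^ 3 \<ge> 5 * r" by (simp add: power3_eq_cube power2_eq_square)
    then have "r ^ 3 + r\<^sup>2 - 2 * r - 4 > 2 * (1 + r)" using r pos by argo
    then show ?thesis using True by linarith
  next
    case False
    then have neg: "r < - 1" using abs_r by auto
    have "r\<^sup>2 * (- r - 1) \<ge> 5 * (- r - 1)" using r neg by (intro mult_right_mono) auto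
    then have "- (r ^ 3) - r\<^sup>2 \<ge> - 5 * r - 5"
      by (simp add: algebra_simps power3_eq_cube power2_eq_square)
    then have "- (r ^ 3 + r\<^sup>2 - 2 * r - 4) > - 2 * (1 + r)" using neg by argo
    then show ?thesis using neg by linarith
  qed
  then have "\<bar>r\<bar> * \<bar>r ^ 3 + r\<^sup>2 - 2 * r - 4\<bar> > \<bar>r\<bar> * (2 * \<bar>1 + r\<bar>)"
    using abs_r by (intro mult_strict_left_mono) auto
  then have "\<bar>r\<bar> * \<bar>r ^ 3 + r\<^sup>2 - 2 * r - 4\<bar> / \<bar>1 + r\<bar> > 2 * \<bar>r\<bar>"
    using r1 by (simp add: field_simps)
  moreover have "2 + (r\<^sup>2 - 1) * (- (r ^ 3 + 2 * r\<^sup>2 - 2) / (1 + r)\<^sup>2)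
      = - (r * (r ^ 3 + r\<^sup>2 - 2 * r - 4) / (1 + r))"
  proof -
    have "(r\<^sup>2 - 1) * (- (r ^ 3 + 2 * r\<^sup>2 - 2) / (1 + r)\<^sup>2) = - ((r - 1) * (r ^ 3 + 2 * r\<^sup>2 - 2) / (1 + r))"
    proof -
      have "r\<^sup>2 - 1 = (r - 1) * (1 + r)" by (simp add: power2_eq_square algebra_simps)
      then have "(r\<^sup>2 - 1) * (- K / (1 + r)\<^sup>2) = - ((r - 1) * K / (1 + r))" for K
        using r1 by (simp add: power2_eq_square[of "1 + r"])
      then show ?thesis .
    qed
    also have "2 + \<dots> = - (r * (r ^ 3 + r\<^sup>2 - 2 * r - 4) / (1 + r))"
      using r1 by (simp add: field_simps power2_eq_square power3_eq_cube)
    finally show ?thesis .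
  qed
  ultimately show ?thesis
    by (simp add: abs_mult abs_divide)
qed

locale dilogarithm = metric_grp +
  fixes E :: "'a \<Rightarrow> complex" and C :: complex
  assumes dilog: "dilogarithm_with_constant q E C"
    and card_gt_4: "CARD('a) > 4"
begin

abbreviation Eh :: "'a \<Rightarrow> complex" where "Eh \<equiv> F E"

definition P :: "'a \<Rightarrow> 'a \<Rightarrow> complex" where
  "P y = F (\<lambda>z. E (y - z) * E z * q z)"

lemma nonzero_exists: "\<exists>u::'a. u \<noteq> 0"
  using exists_nonzero card_gt_4 by simp

lemma C_nonzero [simp]: "C \<noteq> 0"
  using dilog by (simp add: dilogarithm_with_constant_def)

lemma pentagon:
  "b x y * E x * E y = C + 1 / s * (\<Sum>z\<in>UNIV. E (y - z) * E z * q z * E (x - z))"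
  using dilog unfolding dilogarithm_with_constant_def s_def by blast

text \<open>As functions of \<open>x\<close>, the left side of the pentagon is a modulated
  \<open>E\<close>, the right side a constant plus a convolution with \<open>E\<close>; their
  transforms are a shift, a point mass and a product.\<close>

lemma fourier_pentagon: "E y * Eh (w - y) = (if w = 0 then s * C else 0) + Eh w * P y w"
proof -
  have "E y * Eh (w - y) = F (\<lambda>x. E y * (b x y * E x)) w"
    by (simp only: fourier_mult fourier_modulate)
  also have "(\<lambda>x. E y * (b x y * E x))
      = (\<lambda>x. C + 1 / s * (\<Sum>z\<in>UNIV. (E (y - z) * E z * q z) * E (x - z)))"
    using pentagon[of _ y] by (simp add: mult_ac)
  also have "F \<dots> w = (if w = 0 then s * C else 0) + P y w * Eh w"
    unfolding fourier_add fourier_const P_def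
      fourier_convolution[of "\<lambda>z. E (y - z) * E z * q z" E] ..
  finally show ?thesis by simp
qed

text \<open>Substituting \<open>z \<mapsto> y - z\<close> in the defining sum.\<close>
lemma P_reflect: "P y w = q y * b y (- w) * P y (y - w)"
proof -
  have "(\<Sum>z\<in>UNIV. E (y - z) * E z * q z * b z (- w))
      = (\<Sum>z\<in>UNIV. q y * b y (- w) * (E (y - z) * E z * q z * b z (- (y - w))))"
    by (rule sum.reindex_bij_witness[of _ "\<lambda>z. y - z" "\<lambda>z. y - z"])
      (auto simp: q_diff b_diff_left b_diff_right b_minus_right b_minus_left b_self
        b_commute[of y] field_simps power2_eq_square)
  then show ?thesis
    by (simp add: P_def fourier_eq sum_distrib_left mult_ac)
qed

lemma P_inverse: "(\<Sum>w\<in>UNIV. P y w * b z w) = s * (E (y - z) * E z * q z)"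
  unfolding P_def by (rule fourier_inverse)

section \<open>Nonvanishing and the reflection formula for \<open>E\<close>\<close>

lemma Eh_0_nonzero [simp]: "Eh 0 \<noteq> 0"
  using fourier_pentagon[of 0 0] by auto

text \<open>A zero \<open>w\<close> would spread: frequencies 0 and \<open>w\<close> force
  \<open>P w 0 \<noteq> 0\<close> and \<open>Eh w = 0\<close>; the latter kills every
  \<open>E z * Eh (w - z)\<close>, hence every summand of \<open>P w 0\<close>.\<close>

lemma E_nonzero:
  assumes w: "w \<noteq> 0"
  shows "E w \<noteq> 0"
proof
  assume Ew: "E w = 0"
  have Eh_imp_E: "E y = 0" if "y \<noteq> 0" "Eh y = 0" for y
    using fourier_pentagon[of y y] that by simp
  have Pw0: "P w 0 \<noteq> 0"
    using fourier_pentagon[of w 0] Ew by auto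
  then have "P w w \<noteq> 0"
    using P_reflect[of w 0] by auto
  then have "Eh w = 0"
    using fourier_pentagon[of w w] Ew w by auto
  then have zero: "E z = 0 \<or> Eh (w - z) = 0" for z
    using fourier_pentagon[of z w] w by simp
  have "E (w - z) * E z * q z = 0" for z
  proof (cases "z = w")
    case True
    then show ?thesis using Ew by simp
  next
    case False
    then show ?thesis using zero[of z] Eh_imp_E[of "w - z"] by auto
  qed
  then have "P w 0 = 0"
    unfolding P_def fourier_eq by (simp del: mult_eq_0_iff)
  with Pw0 show False by simp
qed

lemma Eh_nonzero:
  assumes w: "w \<noteq> 0"
  shows "Eh w \<noteq> 0"
  using fourier_pentagon[of w w] E_nonzero w by auto

text \<open>Read off from the quadratic equation wanted for \<open>E 0\<close>; finally
  \<open>c = 1\<close>.\<close>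

definition c :: complex where "c = (E 0)\<^sup>2 - s * E 0"

text \<open>For \<open>y = 0\<close> the factor \<open>Eh w\<close> cancels at
  \<open>w \<noteq> 0\<close>, so \<open>P 0\<close> is the constant \<open>E 0\<close> plus a point
  mass at 0. Inversion gives a point mass plus a constant, and \<open>z = 0\<close> identifies the
  constant.\<close>

lemma reflect_q: "E z * E (- z) * q z = c + (if z = 0 then s * E 0 else 0)"
proof -
  define p where "p = P 0 0 - E 0"
  have P0: "P 0 w = (if w = 0 then p else 0) + E 0" for w
    using fourier_pentagon[of 0 w] Eh_nonzero[of w] by (auto simp: p_def)
  have "s * (E z * E (- z) * q z) = (\<Sum>w\<in>UNIV. P 0 w * b z w)" for z
    unfolding P_inverse by (simp add: mult_ac)
  also have "(\<Sum>w\<in>UNIV. P 0 w * b z w)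
      = (\<Sum>w\<in>(UNIV::'a set). (if w = 0 then p else 0)) + E 0 * (\<Sum>w\<in>UNIV. b z w)" for z
    unfolding P0 sum_distrib_left sum.distrib[symmetric]
    by (intro sum.cong) (auto simp: algebra_simps)
  finally have eq: "s * (E z * E (- z) * q z) = p + (if z = 0 then s * s * E 0 else 0)" for z
    by (simp add: sum_b)
  have "p = s * c"
    using eq[of 0] by (simp add: c_def power2_eq_square algebra_simps)
  then have "s * (E z * E (- z) * q z) = s * (c + (if z = 0 then s * E 0 else 0))"
    unfolding eq by (simp add: algebra_simps)
  then show ?thesis by simp
qed

lemma E_reflect: "u \<noteq> 0 \<Longrightarrow> E u * E (- u) * q u = c"
  using reflect_q[of u] by simp

lemma E_0_quadratic: "(E 0)\<^sup>2 = c + s * E 0"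
  by (simp add: c_def)

lemma c_nonzero [simp]: "c \<noteq> 0"
proof -
  obtain u :: 'a where "u \<noteq> 0"
    using nonzero_exists by blast
  then show ?thesis
    using E_reflect[of u] E_nonzero[of u] E_nonzero[of "- u"] by auto
qed

lemma P_0: "P 0 w = s * c * (if w = 0 then 1 else 0) + E 0"
proof -
  have "P 0 w = F (\<lambda>z. c + (if z = 0 then s * E 0 else 0)) w"
    unfolding P_def using reflect_q by (simp add: mult_ac)
  also have "\<dots> = s * c * (if w = 0 then 1 else 0) + E 0"
    unfolding fourier_add fourier_const fourier_delta by simp
  finally show ?thesis .
qed

lemma C_eq: "C = - c * Eh 0"
proof -
  have "s * (C + c * Eh 0) = 0"
    using fourier_pentagon[of 0 0] P_0[of 0] by (simp add: algebra_simps)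
  then show ?thesis by (simp add: add_eq_0_iff)
qed

section \<open>Proportionality of \<open>Eh\<close> and \<open>q * E\<close> away from 0\<close>

lemma Eh_reflect: "\<exists>k. \<forall>w. w \<noteq> 0 \<longrightarrow> Eh w * Eh (- w) = k * q w"
proof -
  \<comment> \<open>Frequencies \<open>w\<close> and \<open>y - w\<close> for the same
    \<open>y\<close> are linked by \<open>P_reflect\<close>. The outcome says that
    \<open>Eh w * Eh (- w) / q w\<close> does not change when \<open>w\<close> is replaced by
    \<open>w - y\<close>.\<close>
  have step: "Eh (w - y) * Eh (y - w) = q y * b y (- w) * (Eh w * Eh (- w))"
    if "y \<noteq> 0" "w \<noteq> 0" "w \<noteq> y" for w y
  proof -
    have 1: "E y * Eh (w - y) = Eh w * P y w"
      using fourier_pentagon[of y w] that by simp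
    have 2: "E y * Eh (- w) = Eh (y - w) * P y (y - w)"
      using fourier_pentagon[of y "y - w"] that by simp
    have "E y * (Eh (w - y) * Eh (y - w)) = Eh w * P y w * Eh (y - w)"
      using 1 by simp
    also have "\<dots> = Eh w * q y * b y (- w) * (Eh (y - w) * P y (y - w))"
      by (subst P_reflect) simp
    also have "\<dots> = E y * (q y * b y (- w) * (Eh w * Eh (- w)))"
      unfolding 2[symmetric] by simp
    finally show ?thesis using E_nonzero[OF \<open>y \<noteq> 0\<close>] by simp
  qed
  obtain u :: 'a where u: "u \<noteq> 0"
    using nonzero_exists by blast
  have "Eh w * Eh (- w) = Eh u * Eh (- u) / q u * q w" if "w \<noteq> 0" for w
  proof (cases "w = u")
    case True
    then show ?thesis by simp
  next
    case False
    then show ?thesis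
      using step[of "u - w" u] that u
      by (simp add: q_diff b_diff_left b_minus_right b_self b_commute[of w] field_simps
        power2_eq_square)
  qed
  then show ?thesis by blast
qed

text \<open>Chosen through \<open>u \<noteq> 0\<close>, because it is only after
  \<open>E_0_eq\<close> that \<open>Eh 0 / E 0\<close> is known to be the same ratio.\<close>

definition lam :: complex where
  "lam = (SOME l. \<forall>u. u \<noteq> 0 \<longrightarrow> Eh u = l * q u * E u)"

text \<open>Frequencies \<open>y\<close> and 0 involve \<open>P y y\<close> and
  \<open>P y 0\<close>, which \<open>P_reflect\<close> ties together. Eliminating both, with
  \<open>Eh_reflect\<close> for \<open>Eh y * Eh (- y)\<close>, leaves an equation linear in
  \<open>Eh y\<close>.\<close>

lemma lam_nonzero [simp]: "lam \<noteq> 0"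
  and Eh_eq: "u \<noteq> 0 \<Longrightarrow> Eh u = lam * q u * E u"
  and lam_quadratic: "lam * s * C = lam\<^sup>2 * c - (Eh 0)\<^sup>2"
proof -
  obtain k where k: "\<And>w. w \<noteq> 0 \<Longrightarrow> Eh w * Eh (- w) = k * q w"
    using Eh_reflect by blast
  define l where "l = (k - (Eh 0)\<^sup>2) / (s * C)"
  have l: "Eh y = l * q y * E y" if y: "y \<noteq> 0" for y
  proof -
    have 1: "E y * Eh 0 = Eh y * P y y"
      using fourier_pentagon[of y y] y by simp
    have 2: "E y * Eh (- y) = s * C + Eh 0 * P y 0"
      using fourier_pentagon[of y 0] by simp
    have "P y 0 = q y * P y y"
      using P_reflect[of y 0] by simp
    then have "q y * (E y * Eh 0) * Eh 0 = Eh y * (E y * Eh (- y) - s * C)"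
      unfolding 1 2 by simp
    also have "\<dots> = E y * (k * q y) - s * C * Eh y"
      using k[OF y] by (simp add: algebra_simps)
    finally have "s * C * Eh y = (k - (Eh 0)\<^sup>2) * q y * E y"
      by (simp add: algebra_simps power2_eq_square)
    then show ?thesis by (simp add: l_def field_simps)
  qed
  obtain u :: 'a where u: "u \<noteq> 0"
    using nonzero_exists by blast
  \<comment> \<open>Comparing the two reflection formulas determines \<open>k\<close>; the
    definition of \<open>l\<close> then becomes the quadratic equation.\<close>
  have "k * q u = l\<^sup>2 * q u * (E u * E (- u) * q u)"
    using k[OF u] l[OF u] l[of "- u"] u by (simp add: power2_eq_square mult_ac)
  then have "k = l\<^sup>2 * c"
    unfolding E_reflect[OF u] by simp
  then have "l * s * C = l\<^sup>2 * c - (Eh 0)\<^sup>2"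
    by (simp add: l_def)
  moreover have "l \<noteq> 0" using l[OF u] Eh_nonzero[OF u] by auto
  moreover have "lam = l"
  proof -
    have "\<forall>u. u \<noteq> 0 \<longrightarrow> Eh u = lam * q u * E u"
      unfolding lam_def by (rule someI[of _ l]) (use l in blast)
    then show ?thesis using l[OF u] u E_nonzero[OF u] by simp
  qed
  ultimately show "lam \<noteq> 0" "u \<noteq> 0 \<Longrightarrow> Eh u = lam * q u * E u"
    "lam * s * C = lam\<^sup>2 * c - (Eh 0)\<^sup>2" for u
    using l by auto
qed

section \<open>The value of \<open>E\<close> at 0\<close>

definition e' :: complex where "e' = Eh 0 / lam"

lemma Eh_0: "Eh 0 = lam * e'"
  by (simp add: e'_def)

lemma e'_nonzero [simp]: "e' \<noteq> 0"
  by (simp add: e'_def)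

text \<open>For \<open>c = 1\<close> this is the quadratic equation of \<open>E 0\<close>, but the
  two could still be different roots; hence the longer argument for \<open>E_0_eq\<close>.\<close>

lemma e'_quadratic: "e'\<^sup>2 = c + s * c * e'"
proof -
  have "lam * s * (- c * (lam * e')) = lam\<^sup>2 * c - (lam * e')\<^sup>2"
    using lam_quadratic C_eq Eh_0 by metis
  then have "lam\<^sup>2 * (e'\<^sup>2 - (c + s * c * e')) = 0"
    by algebra
  then show ?thesis by simp
qed

lemma P_diag: "y \<noteq> 0 \<Longrightarrow> q y * P y y = e'" and P_right_0: "y \<noteq> 0 \<Longrightarrow> P y 0 = e'"
proof -
  assume y: "y \<noteq> 0"
  have "E y * (lam * e') = E y * (lam * (q y * P y y))"
    using fourier_pentagon[of y y] y by (simp add: Eh_eq Eh_0)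
  then show "q y * P y y = e'" using E_nonzero[OF y] by (metis lam_nonzero mult_left_cancel)
  then show "P y 0 = e'" using P_reflect[of y 0] by simp
qed

text \<open>Multiplying the relation at \<open>w\<close> by \<open>E (- w)\<close> trades the factor
  \<open>q w * E w\<close> of \<open>P y w\<close> for \<open>c\<close>.\<close>

lemma P_generic:
  assumes "w \<noteq> 0" "w \<noteq> y"
  shows "c * P y w = E y * (E (w - y) * E (- w) * q (w - y))"
proof -
  have "E y * (lam * q (w - y) * E (w - y)) = lam * q w * E w * P y w"
    using fourier_pentagon[of y w] assms by (simp add: Eh_eq)
  then have "lam * (E y * q (w - y) * E (w - y)) = lam * (q w * E w * P y w)"
    by (simp add: mult_ac)
  then have "E y * q (w - y) * E (w - y) * E (- w) = (E w * E (- w) * q w) * P y w"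
    by simp
  then show ?thesis unfolding E_reflect[OF assms(1)] by (simp add: mult_ac)
qed

text \<open>Fourier inversion for \<open>P y\<close> at 0; the values of \<open>P y\<close> away from 0 and \<open>y\<close> are, up to a
  factor, the summands of \<open>P (- y) 0\<close>.\<close>
lemma E_sum_relation:
  assumes y: "y \<noteq> 0"
  shows "s * (e' - c * E 0) = (E 0 - e') * (E (- y) * (1 + q y))"
proof -
  define R where "R = UNIV - {0, y}"
  have split: "(\<Sum>w\<in>UNIV. f w) = f 0 + f y + (\<Sum>w\<in>R. f w)" for f :: "'a \<Rightarrow> complex"
    unfolding R_def using y
    by (subst sum.remove[of _ 0], simp, simp, subst sum.remove[of _ y])
      (auto simp: Diff_insert2[symmetric] insert_commute)
  have P_R: "c * (\<Sum>w\<in>R. P y w) = E y * (\<Sum>w\<in>R. E (w - y) * E (- w) * q (w - y))"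
    unfolding sum_distrib_left by (rule sum.cong) (auto simp: P_generic R_def)
  have "s * (E y * E 0) = (\<Sum>w\<in>UNIV. P y w)"
    using P_inverse[of y 0] by simp
  also have "\<dots> = e' + P y y + (\<Sum>w\<in>R. P y w)"
    unfolding split using P_right_0[OF y] by simp
  finally have "c * (s * (E y * E 0)) = c * (e' + P y y + (\<Sum>w\<in>R. P y w))"
    by (rule arg_cong)
  also have "c * (e' + P y y + (\<Sum>w\<in>R. P y w))
      = c * (e' + P y y) + E y * (\<Sum>w\<in>R. E (w - y) * E (- w) * q (w - y))"
    by (simp only: distrib_left P_R)
  finally have 1: "c * (s * (E y * E 0)) = c * (e' + P y y) + E y * (\<Sum>w\<in>R. E (w - y) * E (- w) * q (w - y))" .
  have "s * e' = s * P (- y) 0"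
    using P_right_0[of "- y"] y by simp
  also have "\<dots> = (\<Sum>z\<in>UNIV. E (- y - z) * E z * q z)"
    by (simp add: P_def fourier_eq)
  also have "\<dots> = (\<Sum>w\<in>UNIV. E (w - y) * E (- w) * q (w - y))"
    by (rule sum.reindex_bij_witness[of _ "\<lambda>w. w - y" "\<lambda>z. z + y"])
      (auto simp: mult_ac minus_diff_commute)
  also have "\<dots> = E (- y) * E 0 * q y + E 0 * E (- y) + (\<Sum>w\<in>R. E (w - y) * E (- w) * q (w - y))"
    unfolding split using y by simp
  finally have "s * e' = E (- y) * E 0 * q y + E 0 * E (- y)
      + (\<Sum>w\<in>R. E (w - y) * E (- w) * q (w - y))" .
  from arg_cong[OF this, of "\<lambda>x. x * E y"]
  have 2: "s * e' * E y = E (- y) * E y * E 0 * (1 + q y)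
      + E y * (\<Sum>w\<in>R. E (w - y) * E (- w) * q (w - y))"
    by (simp only:) (simp add: algebra_simps)
  \<comment> \<open>Subtracting the two evaluations removes the sum over \<open>R\<close>; the
    factor \<open>q y\<close> makes room for \<open>E_reflect\<close> and
    \<open>P_diag\<close>.\<close>
  have "q y * (s * e' * E y - c * (s * (E y * E 0)))
      = (E y * E (- y) * q y) * E 0 * (1 + q y) - c * (q y * e' + q y * P y y)"
    unfolding 1 2 by (simp add: algebra_simps)
  also have "\<dots> = c * ((E 0 - e') * (1 + q y))"
    unfolding E_reflect[OF y] P_diag[OF y] by (simp add: algebra_simps)
  finally have "q y * (s * e' * E y - c * (s * (E y * E 0))) * E (- y)
      = c * ((E 0 - e') * (1 + q y)) * E (- y)" by simp
  moreover have "q y * (s * e' * E y - c * (s * (E y * E 0))) * E (- y)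
      = (E y * E (- y) * q y) * (s * (e' - c * E 0))"
    by (simp add: algebra_simps)
  ultimately show ?thesis
    unfolding E_reflect[OF y] by simp
qed

lemma q_not_constant: "\<exists>x. x \<noteq> 0 \<and> q x \<noteq> a"
  using constant_imp_card_le[of a] card_gt_4 by fastforce

lemma E_0_eq: "E 0 = e'"
proof (rule ccontr)
  assume ne: "E 0 \<noteq> e'"
  define t where "t = s * (e' - c * E 0) / (E 0 - e')"
  define r where "r = lam * s"
  have t: "E y * (1 + q y) = t" if "y \<noteq> 0" for y
    using E_sum_relation[of "- y"] that ne by (simp add: t_def field_simps)
  have t_nz: "t \<noteq> 0"
  proof
    assume "t = 0"
    then have "q y = - 1" if "y \<noteq> 0" for y
      using t[OF that] E_nonzero[OF that] by (simp add: add_eq_0_iff)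
    then show False using q_not_constant[of "- 1"] by blast
  qed
  have q1: "1 + q y \<noteq> 0" if "y \<noteq> 0" for y
    using t[OF that] t_nz by auto
  have t_sq: "t\<^sup>2 * q y = c * (1 + q y)\<^sup>2" if "y \<noteq> 0" for y
  proof -
    have "t\<^sup>2 * q y = (E y * (1 + q y)) * (E (- y) * (1 + q y)) * q y"
      using t[OF that] t[of "- y"] that by (simp add: power2_eq_square)
    also have "\<dots> = (E y * E (- y) * q y) * (1 + q y)\<^sup>2"
      by (simp add: power2_eq_square mult_ac)
    finally show ?thesis unfolding E_reflect[OF that] .
  qed
  have even: "E (- y) = E y" for y
  proof (cases "y = 0")
    case False
    have "E (- y) * (1 + q y) = E y * (1 + q y)"
      using t[of y] t[of "- y"] False by simp
    then show ?thesis using q1[OF False] by simp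
  qed simp
  have Eh_t: "Eh y = lam * (t - E y)" if "y \<noteq> 0" for y
    unfolding t[OF that, symmetric] Eh_eq[OF that] by (simp add: algebra_simps)
  \<comment> \<open>The point mass at 0 by which \<open>Eh\<close> differs from
    \<open>lam * (t - E)\<close>. Transforming this identity once more returns \<open>E\<close>,
    which is even.\<close>
  define m where "m = Eh 0 - lam * t + lam * E 0"
  have "Eh = (\<lambda>u. (lam * t + (- lam) * E u) + (if u = 0 then m else 0))"
    using Eh_t by (auto simp: m_def algebra_simps)
  then have "F Eh w = F (\<lambda>u. (lam * t + (- lam) * E u) + (if u = 0 then m else 0)) w" for w
    by simp
  then have twice: "E w = (if w = 0 then s * (lam * t) else 0) - lam * Eh w + m / s" for w
    unfolding fourier_add fourier_const fourier_mult fourier_delta fourier_fourier even by simp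
  have E_lin: "(1 - lam\<^sup>2) * E u = m / s - lam\<^sup>2 * t" if "u \<noteq> 0" for u
    using twice[of u] Eh_t[OF that] that by (simp add: algebra_simps power2_eq_square)
  \<comment> \<open>Otherwise \<open>E_lin\<close> makes \<open>E\<close>, and with it
    \<open>q\<close>, constant off 0.\<close>
  have lam_sq: "lam\<^sup>2 = 1"
  proof (rule ccontr)
    assume l: "lam\<^sup>2 \<noteq> 1"
    define K where "K = (m / s - lam\<^sup>2 * t) / (1 - lam\<^sup>2)"
    have K: "E u = K" if "u \<noteq> 0" for u
      using E_lin[OF that] l by (simp add: K_def field_simps)
    have "q u = t / K - 1" if "u \<noteq> 0" for u
      using t[OF that] E_nonzero[OF that] K[OF that] by (simp add: field_simps)
    then show False using q_not_constant[of "t / K - 1"] by blast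
  qed
  have s_r: "s = lam * r"
    using lam_sq by (simp add: r_def power2_eq_square)
  have m_eq: "m = s * t"
    using nonzero_exists E_lin lam_sq by (auto simp: field_simps)
  have sum_e: "E 0 + e' = t * (1 + r)"
    using m_eq lam_sq Eh_0 m_def r_def by algebra
  have r_sq: "r\<^sup>2 = of_nat CARD('a)"
    using lam_sq s_square by (simp add: r_def power_mult_distrib power2_eq_square[of s])
  have r2: "2 + r \<noteq> 0"
  proof
    assume "2 + r = 0"
    then have "r = - 2" by (simp add: add_eq_0_iff)
    then have "r\<^sup>2 = of_nat 4" by simp
    then show False using card_gt_4 unfolding r_sq of_nat_eq_iff by simp
  qed
  have t1: "t * (E 0 - e') = s * (e' - c * E 0)"
    using ne by (simp add: t_def)
  \<comment> \<open>The difference of the quadratic equations for \<open>E 0\<close> and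
    \<open>e'\<close>, factored through \<open>E 0 + e'\<close>.\<close>
  have XY: "E 0 - c * e' = (1 + r) * (e' - c * E 0)"
  proof -
    have "s * (E 0 - c * e') = s * ((1 + r) * (e' - c * E 0))"
      using sum_e t1 E_0_quadratic e'_quadratic by algebra
    then show ?thesis by simp
  qed
  have t_eq: "t = lam * (1 + c)"
  proof -
    have "t * (E 0 - e') = lam * (1 + c) * (E 0 - e')"
      using t1 XY s_r lam_sq by algebra
    then show ?thesis using ne by simp
  qed
  have c1: "1 + c \<noteq> 0" using t_nz t_eq by auto
  \<comment> \<open>\<open>XY\<close> and \<open>sum_e\<close> are linear in \<open>E 0\<close> and
    \<open>e'\<close>; solving them expresses \<open>E 0\<close> by \<open>c\<close>,
    \<open>r\<close> and \<open>lam\<close>, and its quadratic equation then becomes one for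
    \<open>c\<close>.\<close>
  have "(1 + c) * ((2 + r) * (E 0 - e')) = (1 + c) * (lam * r * (1 - c) * (1 + r))"
    using XY sum_e t_eq by algebra
  then have "(2 + r) * (E 0 - e') = lam * r * (1 - c) * (1 + r)"
    using c1 by simp
  then have "2 * ((2 + r) * E 0) = 2 * (lam * (1 + r) * (1 + c + r))"
    using sum_e t_eq by algebra
  then have e_eq: "(2 + r) * E 0 = lam * (1 + r) * (1 + c + r)"
    by simp
  have c_quad: "(1 + r)\<^sup>2 * (c\<^sup>2 + 1) + c * (r ^ 3 + 2 * r\<^sup>2 - 2) = 0"
  proof -
    have "((2 + r) * E 0)\<^sup>2 = (2 + r)\<^sup>2 * c + (2 + r) * s * ((2 + r) * E 0)"
      unfolding power_mult_distrib E_0_quadratic by (simp add: algebra_simps power2_eq_square)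
    then have "lam\<^sup>2 * ((1 + r) * (1 + c + r))\<^sup>2
        = (2 + r)\<^sup>2 * c + lam\<^sup>2 * ((2 + r) * r * ((1 + r) * (1 + c + r)))"
      unfolding e_eq by (simp add: s_r power_mult_distrib) (simp add: power2_eq_square mult_ac)
    then have "((1 + r) * (1 + c + r))\<^sup>2 = (2 + r)\<^sup>2 * c + (2 + r) * r * ((1 + r) * (1 + c + r))"
      unfolding lam_sq by simp
    then show ?thesis by algebra
  qed
  \<comment> \<open>\<open>t_sq\<close> amounts to \<open>q y + 1 / q y = c + 1 / c\<close>, so
    \<open>c_quad\<close> carries over to \<open>q y\<close>.\<close>
  have q_quad: "(1 + r)\<^sup>2 * (q y + inverse (q y)) = - (r ^ 3 + 2 * r\<^sup>2 - 2)" if "y \<noteq> 0" for y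
  proof -
    have "(1 + c)\<^sup>2 * q y = c * (1 + q y)\<^sup>2"
      using t_sq[OF that] lam_sq by (simp add: t_eq power_mult_distrib)
    then have "c * ((1 + r)\<^sup>2 * ((q y)\<^sup>2 + 1)) = c * (- q y * (r ^ 3 + 2 * r\<^sup>2 - 2))"
      using c_quad by algebra
    then have "(1 + r)\<^sup>2 * ((q y)\<^sup>2 + 1) = - q y * (r ^ 3 + 2 * r\<^sup>2 - 2)"
      by (simp only: mult_cancel_left c_nonzero simp_thms)
    then show ?thesis by (simp add: field_simps power2_eq_square)
  qed
  obtain x where x: "x\<^sup>2 = real CARD('a)" and rx: "r = of_real x"
  proof -
    have "lam = 1 \<or> lam = - 1" using lam_sq by (simp add: power2_eq_1_iff)
    then show thesis
      using that[of "sqrt (real CARD('a))"] that[of "- sqrt (real CARD('a))"]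
      by (auto simp: r_def s_def)
  qed
  define T where "T = - (x ^ 3 + 2 * x\<^sup>2 - 2) / (1 + x)\<^sup>2"
  have "1 + x \<noteq> 0"
  proof
    assume "1 + x = 0"
    then have "x\<^sup>2 = 1" by (simp add: add_eq_0_iff2)
    then show False using x card_gt_4 by simp
  qed
  then have q_T: "q y + inverse (q y) = of_real T" if "y \<noteq> 0" for y
  proof -
    have "(1 + r)\<^sup>2 \<noteq> 0"
      using \<open>1 + x \<noteq> 0\<close> unfolding rx by (metis of_real_1 of_real_add of_real_eq_0_iff power_not_zero)
    then have "q y + inverse (q y) = - (r ^ 3 + 2 * r\<^sup>2 - 2) / (1 + r)\<^sup>2"
      using q_quad[OF that] by (metis nonzero_mult_div_cancel_left)
    then show ?thesis by (simp add: T_def rx)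
  qed
  have "(\<Sum>y\<in>UNIV. q y) + (\<Sum>y\<in>UNIV. inverse (q y)) = (\<Sum>y\<in>UNIV. q y + inverse (q y))"
    by (simp add: sum.distrib)
  also have "\<dots> = 2 + (\<Sum>y\<in>UNIV - {0}. q y + inverse (q y))"
    by (subst sum.remove[of _ 0]) auto
  also have "\<dots> = 2 + (of_nat CARD('a) - 1) * of_real T"
    using card_gt_4 by (simp add: q_T card_Diff_subset of_nat_diff)
  also have "\<dots> = of_real (2 + (x\<^sup>2 - 1) * T)"
    by (simp add: x)
  finally have "\<bar>2 + (x\<^sup>2 - 1) * T\<bar> \<le> 2 * sqrt (real CARD('a))"
    using norm_gauss_sum_add_inverse by (simp only: norm_of_real)
  then have "\<bar>2 + (x\<^sup>2 - 1) * T\<bar> \<le> 2 * \<bar>x\<bar>"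
    unfolding x[symmetric] by simp
  moreover have "x\<^sup>2 \<ge> 5" using x card_gt_4 by simp
  ultimately show False
    using real_gauss_sum_bound[of x] unfolding T_def by linarith
qed

section \<open>The constants \<open>c\<close> and \<open>lam\<close>\<close>

lemma E_0_nonzero [simp]: "E 0 \<noteq> 0"
  by (simp add: E_0_eq)

text \<open>Once \<open>E 0 = e'\<close>, the right side of \<open>E_sum_relation\<close>
  vanishes.\<close>

lemma c_eq_1: "c = 1"
proof -
  obtain u :: 'a where "u \<noteq> 0" using nonzero_exists by blast
  then have "s * (E 0 * (1 - c)) = 0"
    using E_sum_relation[of u] unfolding E_0_eq[symmetric] by (simp add: algebra_simps)
  then show ?thesis by simp
qed

lemma lam_eq: "lam = Eh 0 / E 0"
  using E_0_eq by (simp add: e'_def)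

lemma Eh_lam: "Eh u = lam * q u * E u"
  by (cases "u = 0") (simp_all add: Eh_eq lam_eq)

text \<open>The sum of \<open>q x * E x\<close> is computed twice: from \<open>sum_fourier\<close>,
  and by expanding \<open>E x\<close> through inversion, where
  \<open>q x * q w * b x w = q (x + w)\<close> produces a Gauss sum. Comparison gives
  \<open>lam ^ 3 * \<Gamma> = s\<close>.\<close>

lemma lam_cube: "lam ^ 3 = 1 / s * (\<Sum>x\<in>UNIV. inverse (q x))"
proof -
  define \<Gamma> where "\<Gamma> = (\<Sum>x\<in>UNIV. q x)"
  have inner: "(\<Sum>w\<in>UNIV. q x * (Eh w * b x w)) = s * (q x * E x)" for x
    unfolding sum_distrib_left[symmetric] fourier_inverse by simp
  have "s * (\<Sum>x\<in>UNIV. q x * E x) = (\<Sum>x\<in>UNIV. \<Sum>w\<in>UNIV. q x * (Eh w * b x w))"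
    unfolding inner by (rule sum_distrib_left)
  also have "\<dots> = (\<Sum>w\<in>UNIV. \<Sum>x\<in>UNIV. lam * E w * q (x + w))"
    by (subst sum.swap) (simp add: Eh_lam q_add mult_ac)
  also have "\<dots> = (\<Sum>w\<in>UNIV. lam * E w * \<Gamma>)"
  proof (rule sum.cong[OF refl])
    fix w
    have "(\<Sum>x\<in>UNIV. q (x + w)) = \<Gamma>"
      unfolding \<Gamma>_def by (rule sum.reindex_bij_witness[of _ "\<lambda>y. y - w" "\<lambda>x. x + w"]) auto
    then show "(\<Sum>x\<in>UNIV. lam * E w * q (x + w)) = lam * E w * \<Gamma>"
      by (simp add: sum_distrib_left[symmetric])
  qed
  also have "\<dots> = lam * \<Gamma> * (\<Sum>w\<in>UNIV. E w)"
    unfolding sum_distrib_left by (simp add: mult_ac)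
  also have "(\<Sum>w\<in>UNIV. E w) = s * (lam * E 0)"
    using Eh_lam[of 0] by (simp add: fourier_eq field_simps)
  also have "(\<Sum>x\<in>UNIV. q x * E x) = s * E 0 / lam"
  proof -
    have "lam * (\<Sum>x\<in>UNIV. q x * E x) = s * E 0"
      unfolding sum_distrib_left using sum_fourier[of E] by (simp add: Eh_lam mult.assoc)
    then show ?thesis by (simp add: field_simps)
  qed
  finally have "(s * E 0) * s = (s * E 0) * (lam ^ 3 * \<Gamma>)"
    by (simp add: field_simps power3_eq_cube)
  then have "lam ^ 3 * \<Gamma> = s"
    by simp
  moreover have "\<Gamma> * (\<Sum>x\<in>UNIV. inverse (q x)) = s * s"
    unfolding \<Gamma>_def by (rule gauss_sum)
  moreover from this have "\<Gamma> \<noteq> 0" by auto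
  ultimately have "\<Gamma> * (s * lam ^ 3) = \<Gamma> * (\<Sum>x\<in>UNIV. inverse (q x))"
    by (simp add: mult_ac)
  then show ?thesis using \<open>\<Gamma> \<noteq> 0\<close> by (simp add: field_simps)
qed

section \<open>The dual pentagon equation\<close>

abbreviation Et :: "'a \<Rightarrow> complex" where "Et u \<equiv> q u * E u"

lemma fourier_Et: "F Et u = E (- u) / lam"
proof -
  have "Eh = (\<lambda>u. lam * Et u)" by (auto simp: Eh_lam)
  then have "F Eh u = lam * F Et u" by (metis fourier_mult)
  then show ?thesis by (simp add: fourier_fourier field_simps)
qed

text \<open>The transform is \<open>E w * E (- w) * q w\<close>, already known to be 1 plus a point
  mass.\<close>

lemma convolution_E_Et:
  "1 / s * (\<Sum>u\<in>UNIV. E u * Et (x - u)) = (if x = 0 then s else 0) + E 0"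
proof -
  have "(\<lambda>x. 1 / s * (\<Sum>u\<in>UNIV. E u * Et (x - u))) = (\<lambda>x. (if x = 0 then s else 0) + E 0)"
  proof (rule fourier_inject)
    fix w
    have "F (\<lambda>x. 1 / s * (\<Sum>u\<in>UNIV. E u * Et (x - u))) w = E w * E (- w) * q w"
      unfolding fourier_convolution[of E Et] fourier_Et by (simp add: Eh_lam)
    then show "F (\<lambda>x. 1 / s * (\<Sum>u\<in>UNIV. E u * Et (x - u))) w
        = F (\<lambda>x. (if x = 0 then s else 0) + E 0) w"
      unfolding reflect_q fourier_add fourier_const fourier_delta by (simp add: c_eq_1)
  qed
  then show ?thesis by metis
qed

text \<open>Writing out \<open>P z x\<close> and summing over \<open>z\<close> first leaves a
  translate of \<open>convolution_E_Et\<close>: its point mass yields the first term, its constant a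
  multiple of \<open>F Et x\<close>.\<close>

lemma convolution_P_Et:
  "1 / s * (\<Sum>z\<in>UNIV. P z x * Et (y - z)) = Et y * b y (- x) + E 0 * E (- x) / lam"
proof -
  have inner: "1 / s * (\<Sum>z\<in>UNIV. E (z - v) * Et (y - z)) = (if v = y then s else 0) + E 0" for v
  proof -
    have shift: "(\<Sum>z\<in>UNIV. E (z - v) * Et (y - z)) = (\<Sum>u\<in>UNIV. E u * Et (y - v - u))"
      by (rule sum.reindex_bij_witness[of _ "\<lambda>u. u + v" "\<lambda>z. z - v"]) (auto simp: algebra_simps)
    show ?thesis unfolding shift convolution_E_Et by auto
  qed
  have "1 / s * (\<Sum>z\<in>UNIV. P z x * Et (y - z))
      = 1 / s * (\<Sum>z\<in>UNIV. \<Sum>v\<in>UNIV. Et v * b v (- x) * (1 / s * (E (z - v) * Et (y - z))))"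
    by (simp add: P_def fourier_eq sum_distrib_left sum_distrib_right mult_ac)
  also have "\<dots> = 1 / s * (\<Sum>v\<in>UNIV. Et v * b v (- x) * (1 / s * (\<Sum>z\<in>UNIV. E (z - v) * Et (y - z))))"
    by (subst sum.swap) (simp add: sum_distrib_left)
  also have "\<dots> = 1 / s * (\<Sum>v\<in>UNIV. (if v = y then s * (Et y * b y (- x)) else 0) + E 0 * (Et v * b v (- x)))"
    unfolding inner by (intro arg_cong[of _ _ "(*) _"] sum.cong) (auto simp: algebra_simps)
  also have "\<dots> = Et y * b y (- x) + E 0 * F Et x"
    by (simp add: sum.distrib fourier_eq distrib_left sum_distrib_left[symmetric])
  finally show ?thesis by (simp add: fourier_Et)
qed

text \<open>Since \<open>Eh = lam * Et\<close>, \<open>fourier_pentagon\<close> expresses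
  \<open>E z * Et (x - z)\<close> by \<open>P z x\<close>, which turns the sum into that of
  \<open>convolution_P_Et\<close>.\<close>

lemma dual_pentagon:
  "inverse (b x y) * Et x * Et y
    = C / lam\<^sup>2 + 1 / s * (\<Sum>z\<in>UNIV. Et (y - z) * Et z * inverse (q z) * Et (x - z))"
proof -
  define D where "D = (if x = 0 then s * C / lam else 0)"
  have pent: "E z * Et (x - z) = D + Et x * P z x" for z
  proof -
    have "lam * (E z * Et (x - z)) = lam * (D + Et x * P z x)"
      using fourier_pentagon[of z x] unfolding Eh_lam by (simp add: D_def distrib_left mult_ac)
    then show ?thesis by simp
  qed
  have sum_Et: "(\<Sum>z\<in>UNIV. Et (y - z)) = s * (E 0 / lam)"
  proof -
    have "(\<Sum>z\<in>UNIV. Et (y - z)) = (\<Sum>z\<in>UNIV. Et z)"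
      by (rule sum.reindex_bij_witness[of _ "\<lambda>z. y - z" "\<lambda>z. y - z"]) auto
    then show ?thesis using fourier_Et[of 0] by (simp add: fourier_eq field_simps)
  qed
  have "1 / s * (\<Sum>z\<in>UNIV. Et (y - z) * Et z * inverse (q z) * Et (x - z))
      = 1 / s * (\<Sum>z\<in>UNIV. (E z * Et (x - z)) * Et (y - z))"
    by (intro arg_cong[of _ _ "(*) _"] sum.cong) simp_all
  also have "\<dots> = 1 / s * (D * (\<Sum>z\<in>UNIV. Et (y - z)))
      + Et x * (1 / s * (\<Sum>z\<in>UNIV. P z x * Et (y - z)))"
    unfolding pent by (simp add: sum_distrib_left distrib_right distrib_left sum.distrib mult_ac)
  also have "\<dots> = D * (E 0 / lam) + Et x * Et y * b y (- x) + E 0 / lam * (E x * E (- x) * q x)"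
    unfolding convolution_P_Et sum_Et by (simp add: algebra_simps)
  \<comment> \<open>At \<open>x = 0\<close> the term with \<open>D\<close> cancels the point mass of
    \<open>reflect_q\<close>, because \<open>C = - lam * E 0\<close>.\<close>
  also have "\<dots> = Et x * Et y * b y (- x) + E 0 / lam"
    unfolding reflect_q using C_eq Eh_lam[of 0]
    by (simp add: D_def c_eq_1 field_simps)
  finally have "1 / s * (\<Sum>z\<in>UNIV. Et (y - z) * Et z * inverse (q z) * Et (x - z))
      = inverse (b x y) * Et x * Et y + E 0 / lam"
    by (simp add: b_minus_right b_commute[of y] mult_ac)
  moreover have "C / lam\<^sup>2 = - (E 0 / lam)"
    using C_eq Eh_lam[of 0] by (simp add: c_eq_1 power2_eq_square)
  ultimately show ?thesis by simp
qed

end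

theorem theorem5:
  fixes q :: "'a::{finite, ab_group_add} \<Rightarrow> complex"
    and E :: "'a \<Rightarrow> complex" and C :: complex
  assumes "metric_group q"
    and "CARD('a) > 4"
    and "dilogarithm_with_constant q E C"
  shows "let sqrtN = complex_of_real (sqrt (real CARD('a)));
             lam = fourier q E 0 / E 0;
             E' = (\<lambda>u. q u * E u);
             C' = C / lam\<^sup>2
         in ((E 0)\<^sup>2 = sqrtN * E 0 + 1 \<and> C = - fourier q E 0) \<and>
            (\<forall>u. u \<noteq> 0 \<longrightarrow> E u * E (- u) = inverse (q u)) \<and>
            ((\<forall>u. fourier q E u = lam * q u * E u) \<and>
              lam ^ 3 = 1 / sqrtN * (\<Sum>x\<in>UNIV. inverse (q x))) \<and>
            (\<forall>x y. inverse (bich q x y) * E' x * E' y =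
               C' + 1 / sqrtN *
                 (\<Sum>z\<in>UNIV. E' (y - z) * E' z * inverse (q z) * E' (x - z)))"
proof -
  interpret dilogarithm q "complex_of_real (sqrt (real CARD('a)))" E C
    using assms by unfold_locales simp_all
  show ?thesis
    unfolding Let_def lam_eq[symmetric]
  proof (intro conjI allI impI)
    show "(E 0)\<^sup>2 = complex_of_real (sqrt (real CARD('a))) * E 0 + 1"
      using E_0_quadratic c_eq_1 by simp
    show "C = - fourier q E 0"
      using C_eq c_eq_1 by simp
    show "E u * E (- u) = inverse (q u)" if "u \<noteq> 0" for u
      using E_reflect[OF that] c_eq_1 by (simp add: field_simps)
  qed (fact Eh_lam lam_cube dual_pentagon)+
qed

end
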